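(* Let $m\ge1$ and $$T_1(m)=\frac{2m-1+\sqrt{16m^2-14m+3}}{3m-1}.$$ Consider instances in which every job has testing time $t_j=1$. The Uniform-SBS algorithm sorts the jobs by non-increasing upper bound $u_j$, and goes through this sorted list placing each job on a currently least-loaded machine, testing the job if $u_j\ge T_1(m)$ and running it untested otherwise. Then Uniform-SBS is $T_1(m)\left(\frac32-\frac1{2m}\right)$-competitive for non-preemptive makespan minimization on $m$ identical machines with testing on such uniform instances.
   Context: Scheduling with testing on $m$ identical parallel machines: there are $n$ jobs; each job $j$ has a testing time $t_j\ge 0$, an upper bound $u_j\ge 0$ and a processing time $p_j$ with $0\le p_j\le u_j$. A job can either be run untested, occupying a machine for time $u_j$, or be tested and then executed, occupying a machine for total time $t_j+p_j$; the value $p_j$ is revealed to the algorithm only when the test of $j$ is completed. Initially the algorithm knows $m$, $n$ and all $t_j,u_j$, but not the $p_j$. In the non-preemptive setting each job is assigned to a single machine and run there without interruption. The objective is the makespan (maximum machine load). $\mathrm{OPT}$ denotes the minimum makespan achievable by an offline scheduler knowing all $p_j$ (job $j$ needs time $\min(t_j+p_j,u_j)$ in the optimum). A deterministic algorithm is $c$-competitive if its makespan $\mathrm{ALG}$ satisfies $\mathrm{ALG}\le c\cdot\mathrm{OPT}$ on every instance (here: every instance with all $t_j=1$). *)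

theory Defs
  imports Complex_Main "HOL-Library.FuncSet"
begin

text \<open>Jobs are \<open>0, \<dots>, num_jobs I - 1\<close> and machines are \<open>0, \<dots>, m - 1\<close>; the values of
  the job parameters at other indices are irrelevant.\<close>

record testing_instance =
  num_jobs :: nat
  test_time :: "nat \<Rightarrow> real"
  upper_bound :: "nat \<Rightarrow> real"
  proc_time :: "nat \<Rightarrow> real"

definition valid_instance :: "testing_instance \<Rightarrow> bool" where
  "valid_instance I \<longleftrightarrow> (\<forall>j<num_jobs I.
     0 \<le> test_time I j \<and> 0 \<le> upper_bound I j \<and>
     0 \<le> proc_time I j \<and> proc_time I j \<le> upper_bound I j)"

definition uniform_instances :: "testing_instance set" where
  "uniform_instances = {I. valid_instance I \<and> (\<forall>j<num_jobs I. test_time I j = 1)}"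

text \<open>A non-preemptive schedule is a pair \<open>(\<sigma>, D)\<close>: job \<open>j\<close> is run on machine \<open>\<sigma> j\<close>, and \<open>D\<close> is the
  set of jobs that are tested.\<close>

type_synonym schedule = "(nat \<Rightarrow> nat) \<times> nat set"

definition schedules :: "nat \<Rightarrow> testing_instance \<Rightarrow> schedule set" where
  "schedules m I = ({..<num_jobs I} \<rightarrow>\<^sub>E {..<m}) \<times> Pow {..<num_jobs I}"

definition occupation :: "testing_instance \<Rightarrow> nat set \<Rightarrow> nat \<Rightarrow> real" where
  "occupation I D j = (if j \<in> D then test_time I j + proc_time I j else upper_bound I j)"

definition load :: "testing_instance \<Rightarrow> nat set \<Rightarrow> schedule \<Rightarrow> nat \<Rightarrow> real" where
  "load I J S i = (\<Sum>j\<in>{j\<in>J. fst S j = i}. occupation I (snd S) j)"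

definition makespan :: "nat \<Rightarrow> testing_instance \<Rightarrow> schedule \<Rightarrow> real" where
  "makespan m I S = (MAX i\<in>{..<m}. load I {..<num_jobs I} S i)"

definition OPT :: "nat \<Rightarrow> testing_instance \<Rightarrow> real" where
  "OPT m I = (MIN S\<in>schedules m I. makespan m I S)"

text \<open>An algorithm whose description leaves ties open is represented by the set of all schedules it
  may produce on an instance; competitiveness is then required for every way of breaking ties.\<close>

definition competitive ::
  "nat \<Rightarrow> testing_instance set \<Rightarrow> (testing_instance \<Rightarrow> schedule set) \<Rightarrow> real \<Rightarrow> bool" where
  "competitive m \<I> ALG c \<longleftrightarrow> (\<forall>I\<in>\<I>. \<forall>S\<in>ALG I. makespan m I S \<le> c * OPT m I)"

definition T1 :: "nat \<Rightarrow> real" where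
  "T1 m = (2 * real m - 1 + sqrt (16 * (real m)\<^sup>2 - 14 * real m + 3)) / (3 * real m - 1)"

text \<open>\<open>sbs_run m I js S\<close>: \<open>S\<close> is a partial schedule that may have been built after the jobs in \<open>js\<close>
  have been handled in this order. Each choice depends on processing times only through the current
  loads, that is, only on those of jobs already tested.\<close>

inductive sbs_run :: "nat \<Rightarrow> testing_instance \<Rightarrow> nat list \<Rightarrow> schedule \<Rightarrow> bool"
  for m :: nat and I :: testing_instance where
  start: "sbs_run m I [] (\<lambda>_. undefined, {})"
| place: "sbs_run m I js (\<sigma>, D) \<Longrightarrow> i < m \<Longrightarrow>
    (\<forall>k<m. load I (set js) (\<sigma>, D) i \<le> load I (set js) (\<sigma>, D) k) \<Longrightarrow>
    sbs_run m I (js @ [j]) (\<sigma>(j := i), if upper_bound I j \<ge> T1 m then insert j D else D)"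

definition uniform_SBS :: "nat \<Rightarrow> testing_instance \<Rightarrow> schedule set" where
  "uniform_SBS m I = {S. \<exists>js. distinct js \<and> set js = {..<num_jobs I} \<and>
     sorted_wrt (\<lambda>j k. upper_bound I j \<ge> upper_bound I k) js \<and> sbs_run m I js S}"

text \<open>Sanity checks: the minimum in \<open>OPT\<close> ranges over a finite nonempty set, the optimum spends
  \<open>min (t\<^sub>j + p\<^sub>j) u\<^sub>j\<close> on each job, and the algorithm always produces a schedule.\<close>

lemma finite_schedules: "finite (schedules m I)"
  by (auto simp: schedules_def intro!: finite_cartesian_product finite_PiE)

lemma schedules_nonempty: "m \<ge> 1 \<Longrightarrow> schedules m I \<noteq> {}"
  by (auto simp: schedules_def PiE_eq_empty_iff lessThan_empty_iff)

lemma makespan_mono: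
  assumes "m \<ge> 1" "\<And>j. j < num_jobs I \<Longrightarrow> occupation I D j \<le> occupation I D' j"
  shows "makespan m I (\<sigma>, D) \<le> makespan m I (\<sigma>, D')"
proof -
  have "load I {..<num_jobs I} (\<sigma>, D) i \<le> load I {..<num_jobs I} (\<sigma>, D') i" for i
    unfolding load_def by (auto intro!: sum_mono assms(2))
  note le = this
  have "{..<m} \<noteq> {}" using assms(1) by (auto simp: lessThan_empty_iff)
  then show ?thesis
    unfolding makespan_def
    by (intro Max.boundedI) (auto intro!: order_trans[OF le] Max_ge)
qed

lemma OPT_eq:
  assumes "m \<ge> 1"
  shows "OPT m I = (MIN \<sigma>\<in>{..<num_jobs I} \<rightarrow>\<^sub>E {..<m}. MAX i\<in>{..<m}.
    \<Sum>j | j < num_jobs I \<and> \<sigma> j = i. min (test_time I j + proc_time I j) (upper_bound I j))"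
proof -
  let ?n = "num_jobs I"
  let ?P = "{..<?n} \<rightarrow>\<^sub>E {..<m}"
  define D where "D = {j. j < ?n \<and> test_time I j + proc_time I j \<le> upper_bound I j}"
  have occ: "occupation I D j = min (test_time I j + proc_time I j) (upper_bound I j)"
    if "j < ?n" for j
    using that by (auto simp: occupation_def D_def)
  have ms: "makespan m I (\<sigma>, D) = (MAX i\<in>{..<m}. \<Sum>j | j < ?n \<and> \<sigma> j = i.
      min (test_time I j + proc_time I j) (upper_bound I j))" for \<sigma>
    by (simp add: makespan_def load_def occ cong: conj_cong)
  have fin: "finite ?P" by (auto intro: finite_PiE)
  have ne: "?P \<noteq> {}" using assms by (auto simp: PiE_eq_empty_iff lessThan_empty_iff)
  have sub: "(\<sigma>, D) \<in> schedules m I" if "\<sigma> \<in> ?P" for \<sigma>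
    using that by (auto simp: schedules_def D_def)
  have "OPT m I = (MIN \<sigma>\<in>?P. makespan m I (\<sigma>, D))"
  proof (rule antisym)
    show "OPT m I \<le> (MIN \<sigma>\<in>?P. makespan m I (\<sigma>, D))"
      unfolding OPT_def using fin ne sub finite_schedules[of m I]
      by (intro Min_antimono) auto
    show "(MIN \<sigma>\<in>?P. makespan m I (\<sigma>, D)) \<le> OPT m I"
      unfolding OPT_def
    proof (rule Min.boundedI)
      fix x assume "x \<in> makespan m I ` schedules m I"
      then obtain \<sigma> E where x: "x = makespan m I (\<sigma>, E)" and \<sigma>: "\<sigma> \<in> ?P"
        by (auto simp: schedules_def)
      have "makespan m I (\<sigma>, D) \<le> x"
        unfolding x by (rule makespan_mono[OF assms]) (simp add: occ, simp add: occupation_def)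
      then show "(MIN \<sigma>\<in>?P. makespan m I (\<sigma>, D)) \<le> x"
        using fin \<sigma> by (meson Min_le finite_imageI image_eqI order_trans)
    qed (use finite_schedules schedules_nonempty[OF assms] in auto)
  qed
  then show ?thesis by (simp add: ms)
qed

lemma sbs_run_schedule:
  assumes "sbs_run m I js S"
  shows "fst S \<in> set js \<rightarrow>\<^sub>E {..<m} \<and> snd S \<subseteq> set js"
  using assms by induction (auto simp: PiE_def extensional_def Pi_def)

lemma uniform_SBS_schedules: "uniform_SBS m I \<subseteq> schedules m I"
  using sbs_run_schedule by (fastforce simp: uniform_SBS_def schedules_def)

lemma sbs_run_exists:
  assumes "m \<ge> 1"
  shows "\<exists>S. sbs_run m I js S"
proof (induction js rule: rev_induct)
  case Nil
  show ?case using sbs_run.start by blast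
next
  case (snoc j js)
  then obtain \<sigma> D where run: "sbs_run m I js (\<sigma>, D)" by auto
  have "{..<m} \<noteq> {}" using assms by (auto simp: lessThan_empty_iff)
  then obtain i where "i \<in> {..<m}"
      "\<forall>k\<in>{..<m}. load I (set js) (\<sigma>, D) i \<le> load I (set js) (\<sigma>, D) k"
    using ex_min_if_finite[of "load I (set js) (\<sigma>, D) ` {..<m}"] by force
  then show ?case using sbs_run.place[OF run] by blast
qed

lemma uniform_SBS_nonempty:
  assumes "m \<ge> 1"
  shows "uniform_SBS m I \<noteq> {}"
proof -
  define js where "js = sort_key (\<lambda>j. - upper_bound I j) [0..<num_jobs I]"
  have "sorted (map (\<lambda>j. - upper_bound I j) js)" by (simp add: js_def)
  then have "sorted_wrt (\<lambda>j k. upper_bound I j \<ge> upper_bound I k) js"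
    by (simp add: sorted_wrt_map)
  moreover have "distinct js" "set js = {..<num_jobs I}" by (auto simp: js_def)
  ultimately show ?thesis
    using sbs_run_exists[OF assms, of I js] by (auto simp: uniform_SBS_def)
qed

end

theory Submission imports Defs begin

text \<open>Write \<open>T = T1 m\<close> and \<open>R = T (3/2 - 1/(2m))\<close>, and consider the moment at which a job \<open>l\<close> is put
  on a least loaded machine. An untested job costs at most \<open>T\<close> times its optimal cost, a tested
  one at most \<open>1 + 1/T \<le> T\<close> times. If \<open>l\<close> is tested then, by the sorting, so are all
  earlier jobs, and the usual list scheduling argument bounds the new load by
  \<open>(1 + 1/T) (2 - 1/m) OPT\<close>. If \<open>l\<close> is untested and not the first job on its machine, then
  at least \<open>m + 1\<close> jobs have upper bound at least \<open>u\<^sub>l\<close>; two of them share a machine in the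
  optimum, so \<open>OPT \<ge> 2 min 1 u\<^sub>l \<ge> 2 u\<^sub>l / T\<close>, and list scheduling gives \<open>R OPT\<close>. The
  threshold \<open>T\<close> is the positive root of \<open>(1 + 1/T) (2 - 1/m) = R\<close>.\<close>

definition opt_time :: "testing_instance \<Rightarrow> nat \<Rightarrow> real" where
  "opt_time I j = min (test_time I j + proc_time I j) (upper_bound I j)"

text \<open>The decision to test depends on the upper bound alone, so the cost of a job is fixed
  before the run and no set of tested jobs has to be carried along.\<close>

definition sbs_time :: "nat \<Rightarrow> testing_instance \<Rightarrow> nat \<Rightarrow> real" where
  "sbs_time m I j =
    (if upper_bound I j \<ge> T1 m then test_time I j + proc_time I j else upper_bound I j)"

section \<open>Algebra of the threshold\<close>

text \<open>The equation \<open>(1 + 1/T) (2 - 1/m) = T (3/2 - 1/(2m))\<close> with denominators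
  cleared.\<close>

lemma T1_root:
  assumes "m \<ge> 1"
  shows "(3 * real m - 1) * (T1 m)\<^sup>2 = (4 * real m - 2) * (T1 m + 1)"
proof -
  define x where "x = real m"
  define s where "s = sqrt (16 * x\<^sup>2 - 14 * x + 3)"
  have x: "x \<ge> 1" using assms by (simp add: x_def)
  \<comment> \<open>Expanding around \<open>x = 1\<close> makes every coefficient positive.\<close>
  have "16 * x\<^sup>2 - 14 * x + 3 = 16 * (x - 1)\<^sup>2 + 18 * (x - 1) + 5"
    by (simp add: power2_eq_square algebra_simps)
  with x have "16 * x\<^sup>2 - 14 * x + 3 \<ge> 0" by (smt (verit) zero_le_power2)
  then have s: "s\<^sup>2 = 16 * x\<^sup>2 - 14 * x + 3" by (simp add: s_def)
  have d: "3 * x - 1 \<noteq> 0" using x by simp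
  define T where "T = T1 m"
  have T: "(3 * x - 1) * T = 2 * x - 1 + s"
    using d by (simp add: T_def T1_def x_def s_def)
  \<comment> \<open>The extra factor \<open>3 * x - 1\<close> turns the left side into the square of
    the numerator \<open>2 * x - 1 + s\<close>.\<close>
  have "(3 * x - 1) * ((3 * x - 1) * T\<^sup>2) = ((3 * x - 1) * T)\<^sup>2"
    by (simp add: power2_eq_square)
  also have "\<dots> = (4 * x - 2) * ((3 * x - 1) * T + (3 * x - 1))"
    unfolding T using s by (simp add: power2_eq_square algebra_simps)
  also have "\<dots> = (3 * x - 1) * ((4 * x - 2) * (T + 1))"
    by (simp add: algebra_simps)
  finally show ?thesis using d by (simp add: x_def T_def)
qed

text \<open>The square root is at least \<open>m\<close>, so the numerator of \<open>T1 m\<close> is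
  at least its denominator \<open>3m - 1\<close>.\<close>

lemma T1_ge_1:
  assumes "m \<ge> 1"
  shows "T1 m \<ge> 1"
proof -
  define x where "x = real m"
  have x: "x \<ge> 1" using assms by (simp add: x_def)
  have "x\<^sup>2 \<le> 16 * x\<^sup>2 - 14 * x + 3"
  proof -
    have "16 * x\<^sup>2 - 14 * x + 3 - x\<^sup>2 = 15 * (x - 1)\<^sup>2 + 16 * (x - 1) + 4"
      by (simp add: power2_eq_square algebra_simps)
    with x show ?thesis by (smt (verit) zero_le_power2)
  qed
  then have "x \<le> sqrt (16 * x\<^sup>2 - 14 * x + 3)" using real_le_rsqrt by blast
  with x show ?thesis by (simp add: T1_def x_def[symmetric] field_simps)
qed

text \<open>Since \<open>3m - 1 \<le> 4m - 2\<close>, the quadratic equation gives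
  \<open>T + 1 \<le> T\<^sup>2\<close>. Hence the ratio \<open>T\<close> also covers tested jobs,
  which may precede an untested one.\<close>

lemma T1_golden:
  assumes "m \<ge> 1"
  shows "1 + 1 / T1 m \<le> T1 m"
proof -
  have T: "T1 m \<ge> 1" by (rule T1_ge_1[OF assms])
  have "(3 * real m - 1) * (T1 m + 1) \<le> (4 * real m - 2) * (T1 m + 1)"
    using assms T by (intro mult_right_mono) auto
  then have "(3 * real m - 1) * (T1 m + 1) \<le> (3 * real m - 1) * (T1 m)\<^sup>2"
    by (simp add: T1_root[OF assms])
  then have "T1 m + 1 \<le> (T1 m)\<^sup>2" using assms by simp
  with T show ?thesis by (simp add: field_simps power2_eq_square)
qed

lemma T1_ratio:
  assumes "m \<ge> 1"
  shows "(1 + 1 / T1 m) * (2 * real m - 1) = real m * (T1 m * (3 / 2 - 1 / (2 * real m)))"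
proof -
  have "real m * (T1 m * (3 / 2 - 1 / (2 * real m))) = T1 m * (3 * real m - 1) / 2"
    using assms by (simp add: field_simps)
  moreover have "(1 + 1 / T1 m) * (2 * real m - 1) = T1 m * (3 * real m - 1) / 2"
    using T1_root[OF assms] T1_ge_1[OF assms] by (simp add: field_simps power2_eq_square)
  ultimately show ?thesis by (rule trans[OF _ sym, rotated])
qed

section \<open>Lower bounds on the optimum\<close>

text \<open>A minimiser in \<open>OPT_eq\<close>, where the tests are already chosen optimally; the
  lower bounds on \<open>OPT\<close> below all start from it.\<close>

lemma optimal_assignment:
  assumes "m \<ge> 1"
  obtains \<sigma> where "\<sigma> \<in> {..<num_jobs I} \<rightarrow> {..<m}"
    and "\<And>i. i < m \<Longrightarrow> (\<Sum>j | j < num_jobs I \<and> \<sigma> j = i. opt_time I j) \<le> OPT m I"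
proof -
  let ?P = "{..<num_jobs I} \<rightarrow>\<^sub>E {..<m}"
  let ?f = "\<lambda>\<sigma>. MAX i\<in>{..<m}. \<Sum>j | j < num_jobs I \<and> \<sigma> j = i. opt_time I j"
  have "finite ?P" by (auto intro: finite_PiE)
  moreover have "?P \<noteq> {}" using assms by (auto simp: PiE_eq_empty_iff lessThan_empty_iff)
  ultimately have "Min (?f ` ?P) \<in> ?f ` ?P" by (intro Min_in) auto
  then obtain \<sigma> where \<sigma>: "\<sigma> \<in> ?P" "OPT m I = ?f \<sigma>"
    unfolding OPT_eq[OF assms] opt_time_def by auto
  show ?thesis
  proof
    show "\<sigma> \<in> {..<num_jobs I} \<rightarrow> {..<m}" using \<sigma>(1) by auto
    show "(\<Sum>j | j < num_jobs I \<and> \<sigma> j = i. opt_time I j) \<le> OPT m I" if "i < m" for i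
      unfolding \<sigma>(2) using that by (intro Max_ge) auto
  qed
qed

lemma opt_time_nonneg:
  "valid_instance I \<Longrightarrow> j < num_jobs I \<Longrightarrow> 0 \<le> opt_time I j"
  by (simp add: valid_instance_def opt_time_def)

lemma opt_time_le_OPT:
  assumes "m \<ge> 1" "valid_instance I" "j < num_jobs I"
  shows "opt_time I j \<le> OPT m I"
proof -
  obtain \<sigma> where \<sigma>: "\<sigma> \<in> {..<num_jobs I} \<rightarrow> {..<m}"
    "\<And>i. i < m \<Longrightarrow> (\<Sum>j | j < num_jobs I \<and> \<sigma> j = i. opt_time I j) \<le> OPT m I"
    using optimal_assignment[OF assms(1)] by blast
  have "opt_time I j \<le> (\<Sum>k | k < num_jobs I \<and> \<sigma> k = \<sigma> j. opt_time I k)"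
    using assms by (intro member_le_sum) (auto intro: opt_time_nonneg)
  also have "\<dots> \<le> OPT m I" using \<sigma> assms(3) by auto
  finally show ?thesis .
qed

lemma sum_opt_time_le:
  assumes "m \<ge> 1" "valid_instance I" "A \<subseteq> {..<num_jobs I}"
  shows "(\<Sum>j\<in>A. opt_time I j) \<le> real m * OPT m I"
proof -
  obtain \<sigma> where \<sigma>: "\<sigma> \<in> {..<num_jobs I} \<rightarrow> {..<m}"
    "\<And>i. i < m \<Longrightarrow> (\<Sum>j | j < num_jobs I \<and> \<sigma> j = i. opt_time I j) \<le> OPT m I"
    using optimal_assignment[OF assms(1)] by blast
  have "(\<Sum>j\<in>A. opt_time I j) \<le> (\<Sum>j<num_jobs I. opt_time I j)"
    using assms by (intro sum_mono2) (auto intro: opt_time_nonneg)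
  also have "\<dots> = (\<Sum>i<m. \<Sum>j\<in>{j\<in>{..<num_jobs I}. \<sigma> j = i}. opt_time I j)"
    using \<sigma>(1) by (intro sum.group[symmetric]) auto
  also have "\<dots> \<le> (\<Sum>i<m. OPT m I)"
    using \<sigma>(2) by (intro sum_mono) auto
  finally show ?thesis by simp
qed

text \<open>Pigeonhole: two of the more than \<open>m\<close> jobs share a machine in an optimal
  assignment.\<close>

lemma OPT_ge_twice:
  assumes "m \<ge> 1" "valid_instance I" "A \<subseteq> {..<num_jobs I}" "card A > m"
    and c: "\<And>j. j \<in> A \<Longrightarrow> c \<le> opt_time I j"
  shows "2 * c \<le> OPT m I"
proof -
  obtain \<sigma> where \<sigma>: "\<sigma> \<in> {..<num_jobs I} \<rightarrow> {..<m}"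
    "\<And>i. i < m \<Longrightarrow> (\<Sum>j | j < num_jobs I \<and> \<sigma> j = i. opt_time I j) \<le> OPT m I"
    using optimal_assignment[OF assms(1)] by blast
  have "card (\<sigma> ` A) \<le> card {..<m}"
    using \<sigma>(1) assms(3) by (intro card_mono) auto
  with assms(4) have "\<not> inj_on \<sigma> A" by (auto dest: card_image)
  then obtain j k where jk: "j \<in> A" "k \<in> A" "j \<noteq> k" "\<sigma> j = \<sigma> k"
    by (auto simp: inj_on_def)
  have "2 * c \<le> (\<Sum>i\<in>{j, k}. opt_time I i)"
    using c[OF jk(1)] c[OF jk(2)] jk(3) by simp
  also have "\<dots> \<le> (\<Sum>i | i < num_jobs I \<and> \<sigma> i = \<sigma> j. opt_time I i)"
    using jk assms(3) by (intro sum_mono2) (auto intro: opt_time_nonneg[OF assms(2)])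
  also have "\<dots> \<le> OPT m I" using \<sigma> jk(1) assms(3) by auto
  finally show ?thesis .
qed

section \<open>Cost of single jobs against the optimum\<close>

lemma sbs_time_tested:
  assumes "m \<ge> 1" "I \<in> uniform_instances" "j < num_jobs I" "upper_bound I j \<ge> T1 m"
  shows "sbs_time m I j \<le> (1 + 1 / T1 m) * opt_time I j"
proof -
  define T u p where "T = T1 m" and "u = upper_bound I j" and "p = proc_time I j"
  have T: "T \<ge> 1" using T1_ge_1[OF assms(1)] by (simp add: T_def)
  have I: "0 \<le> p" "p \<le> u" "test_time I j = 1" "T \<le> u"
    using assms(2-4) by (auto simp: uniform_instances_def valid_instance_def T_def u_def p_def)
  have "1 + p \<le> (1 + 1 / T) * (1 + p)"
    using T I(1) by (intro mult_le_cancel_right1[THEN iffD2]) auto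
  \<comment> \<open>Here \<open>p \<le> u\<close>, and \<open>1 \<le> u / T\<close> because the job
    is tested.\<close>
  moreover have "1 + p \<le> (1 + 1 / T) * u"
    using T I by (simp add: field_simps) (smt (verit) mult_left_mono)
  ultimately have "1 + p \<le> (1 + 1 / T) * min (1 + p) u" by (simp add: min_def)
  with I show ?thesis by (simp add: sbs_time_def opt_time_def T_def u_def p_def)
qed

text \<open>Both \<open>u < T\<close> and \<open>u \<le> T * u\<close> hold. Unlike
  \<open>opt_time\<close>, the term \<open>min 1 u\<close> is monotone in the upper bound alone, so
  sorting carries it over to earlier jobs.\<close>

lemma sbs_time_untested:
  assumes "m \<ge> 1" "I \<in> uniform_instances" "j < num_jobs I" "upper_bound I j < T1 m"
  shows "sbs_time m I j \<le> T1 m * min 1 (upper_bound I j)"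
proof -
  have "0 \<le> upper_bound I j"
    using assms(2,3) by (auto simp: uniform_instances_def valid_instance_def)
  then have "upper_bound I j \<le> T1 m * upper_bound I j"
    using T1_ge_1[OF assms(1)] by (intro mult_le_cancel_right1[THEN iffD2]) auto
  with assms(4) show ?thesis by (simp add: sbs_time_def min_def)
qed

lemma min_1_upper_bound_le_opt_time:
  assumes "I \<in> uniform_instances" "j < num_jobs I"
  shows "min 1 (upper_bound I j) \<le> opt_time I j"
  using assms by (auto simp: uniform_instances_def valid_instance_def opt_time_def)

lemma sbs_time_le:
  assumes "m \<ge> 1" "I \<in> uniform_instances" "j < num_jobs I"
  shows "sbs_time m I j \<le> T1 m * opt_time I j"
proof (cases "upper_bound I j \<ge> T1 m")
  case True
  have "0 \<le> opt_time I j"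
    using assms by (auto simp: uniform_instances_def intro: opt_time_nonneg)
  then have "(1 + 1 / T1 m) * opt_time I j \<le> T1 m * opt_time I j"
    using T1_golden[OF assms(1)] by (rule mult_right_mono[rotated])
  with sbs_time_tested[OF assms True] show ?thesis by linarith
next
  case False
  have "T1 m * min 1 (upper_bound I j) \<le> T1 m * opt_time I j"
    using min_1_upper_bound_le_opt_time[OF assms(2,3)] T1_ge_1[OF assms(1)]
    by (intro mult_left_mono) auto
  with sbs_time_untested[OF assms] False show ?thesis by linarith
qed

section \<open>The list scheduling argument\<close>

text \<open>\<open>L\<close> is at most the average load from \<open>A\<close>, so
  \<open>m * L\<close> plus one copy of \<open>a l\<close> is charged to the optimum via the ratio
  \<open>c\<close>; the other \<open>m - 1\<close> copies of \<open>a l\<close> remain to be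
  bounded.\<close>

lemma list_scheduling_step:
  fixes a b :: "nat \<Rightarrow> real"
  assumes "finite A" "l \<notin> A" "real m * L \<le> sum a A"
    and "sum b (insert l A) \<le> real m * P" "0 \<le> c"
    and ab: "\<And>k. k \<in> insert l A \<Longrightarrow> a k \<le> c * b k"
  shows "real m * (L + a l) \<le> c * (real m * P) + (real m - 1) * a l"
proof -
  have "sum a (insert l A) \<le> c * sum b (insert l A)"
    unfolding sum_distrib_left using ab by (rule sum_mono)
  also have "\<dots> \<le> c * (real m * P)" using assms by (intro mult_left_mono) auto
  finally have "a l + sum a A \<le> c * (real m * P)" using assms by simp
  with assms(3) show ?thesis by (simp add: algebra_simps)
qed

text \<open>The core estimate, detached from runs: \<open>A\<close> stands for the jobs placed
  before \<open>l\<close>, and \<open>L\<close> for the least load at that moment.\<close>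

lemma sbs_new_load_le:
  assumes m: "m \<ge> 1" and I: "I \<in> uniform_instances"
    and A: "A \<subseteq> {..<num_jobs I}" and l: "l < num_jobs I" "l \<notin> A"
    and sorted: "\<And>k. k \<in> A \<Longrightarrow> upper_bound I l \<le> upper_bound I k"
    and L: "real m * L \<le> sum (sbs_time m I) A" and first: "L \<le> 0 \<or> card A \<ge> m"
  shows "L + sbs_time m I l \<le> T1 m * (3 / 2 - 1 / (2 * real m)) * OPT m I"
proof -
  define T R P a where "T = T1 m" and "R = T1 m * (3 / 2 - 1 / (2 * real m))"
    and "P = OPT m I" and "a = sbs_time m I l"
  have valid: "valid_instance I" using I by (simp add: uniform_instances_def)
  have T: "T \<ge> 1" using T1_ge_1[OF m] by (simp add: T_def)
  have P: "opt_time I l \<le> P" "0 \<le> P"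
    using opt_time_le_OPT[OF m valid l(1)] opt_time_nonneg[OF valid l(1)] by (auto simp: P_def)
  have fin: "finite A" using A finite_subset by blast
  have sub: "insert l A \<subseteq> {..<num_jobs I}" using A l by auto
  note total = sum_opt_time_le[OF m valid sub, folded P_def]
  have "L + a \<le> R * P"
  proof (cases "upper_bound I l \<ge> T1 m")
    case True
    \<comment> \<open>By the sorting, every earlier job also reaches the threshold.\<close>
    have tested: "sbs_time m I k \<le> (1 + 1 / T) * opt_time I k" if "k \<in> insert l A" for k
      using that sub True sorted[of k] unfolding T_def
      by (intro sbs_time_tested[OF m I]) auto
    have "a \<le> (1 + 1 / T) * opt_time I l" using tested[of l] by (simp add: a_def)
    also have "\<dots> \<le> (1 + 1 / T) * P" using P T by (intro mult_left_mono) auto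
    finally have a: "(real m - 1) * a \<le> (real m - 1) * ((1 + 1 / T) * P)"
      using m by (intro mult_left_mono) auto
    have "real m * (L + a) \<le> (1 + 1 / T) * (real m * P) + (real m - 1) * a"
      unfolding a_def
      by (rule list_scheduling_step[OF fin l(2) L total _ tested]) (use T in auto)
    also have "\<dots> \<le> (1 + 1 / T) * (2 * real m - 1) * P"
    proof -
      have "(1 + 1 / T) * (2 * real m - 1) * P =
          (1 + 1 / T) * (real m * P) + (real m - 1) * ((1 + 1 / T) * P)"
        by (simp only: ring_distribs) (simp add: algebra_simps)
      with a show ?thesis by linarith
    qed
    also have "\<dots> = real m * (R * P)" unfolding T_def R_def T1_ratio[OF m] by simp
    finally show ?thesis using m by simp
  next
    case False
    show ?thesis
    proof (cases "L \<le> 0")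
      case True
      have "1 / (2 * real m) \<le> 1 / 2" using m by simp
      then have "T * 1 \<le> R" unfolding R_def T_def[symmetric]
        using T by (intro mult_left_mono) auto
      have "a \<le> T * opt_time I l" using sbs_time_le[OF m I l(1)] by (simp add: a_def T_def)
      also have "\<dots> \<le> T * P" using P T by (intro mult_left_mono) auto
      also have "\<dots> \<le> R * P" using \<open>T * 1 \<le> R\<close> P by (intro mult_right_mono) auto
      finally show ?thesis using True by simp
    next
      case pos: False
      have "2 * min 1 (upper_bound I l) \<le> P" unfolding P_def
      proof (rule OPT_ge_twice[OF m valid sub])
        show "m < card (insert l A)" using pos first fin l(2) by simp
        show "min 1 (upper_bound I l) \<le> opt_time I k" if "k \<in> insert l A" for k
        proof -
          have "min 1 (upper_bound I l) \<le> min 1 (upper_bound I k)"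
            using that sorted by (intro min.mono) auto
          also have "\<dots> \<le> opt_time I k"
            using that sub by (intro min_1_upper_bound_le_opt_time[OF I]) auto
          finally show ?thesis .
        qed
      qed
      \<comment> \<open>The last job costs at most half of \<open>T * P\<close>, and
        \<open>m + (m - 1)/2 = m (3/2 - 1/(2m))\<close> yields the ratio.\<close>
      then have "T * min 1 (upper_bound I l) \<le> T * (P / 2)"
        using T by (intro mult_left_mono) auto
      with sbs_time_untested[OF m I l(1)] False have "a \<le> T * (P / 2)"
        by (simp add: a_def T_def)
      then have a: "(real m - 1) * a \<le> (real m - 1) * (T * (P / 2))"
        using m by (intro mult_left_mono) auto
      have "real m * (L + a) \<le> T * (real m * P) + (real m - 1) * a"
        unfolding a_def
      proof (rule list_scheduling_step[OF fin l(2) L total])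
        show "sbs_time m I k \<le> T * opt_time I k" if "k \<in> insert l A" for k
          using that sub unfolding T_def by (intro sbs_time_le[OF m I]) auto
      qed (use T in auto)
      also have "\<dots> \<le> T * (real m * P) + (real m - 1) * (T * (P / 2))" using a by simp
      also have "\<dots> = real m * (R * P)"
        using m by (simp add: R_def T_def field_simps)
      finally show ?thesis using m by simp
    qed
  qed
  then show ?thesis by (simp add: a_def R_def P_def)
qed

section \<open>Induction along a run\<close>

lemma sbs_run_tested: "sbs_run m I js S \<Longrightarrow> snd S = {j \<in> set js. upper_bound I j \<ge> T1 m}"
  by (induction rule: sbs_run.induct) auto

lemma sbs_run_load:
  assumes "sbs_run m I js S"
  shows "load I (set js) S i = (\<Sum>j\<in>{j \<in> set js. fst S j = i}. sbs_time m I j)"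
  unfolding load_def sbs_run_tested[OF assms]
  by (rule sum.cong) (auto simp: occupation_def sbs_time_def)

text \<open>Stated for partial runs, with \<open>OPT\<close> taken for the whole instance, so that
  induction on the placed jobs applies: only the chosen machine changes its load.\<close>

lemma sbs_run_load_le:
  assumes "sbs_run m I js S" and m: "m \<ge> 1" and I: "I \<in> uniform_instances"
    and "distinct js" "set js \<subseteq> {..<num_jobs I}"
    and "sorted_wrt (\<lambda>j k. upper_bound I j \<ge> upper_bound I k) js" "k < m"
  shows "load I (set js) S k \<le> T1 m * (3 / 2 - 1 / (2 * real m)) * OPT m I"
  using assms(1,4-)
proof (induction arbitrary: k rule: sbs_run.induct)
  case start
  have "1 / (2 * real m) \<le> 1 / 2" using m by simp
  moreover have "0 \<le> OPT m I"
    using sum_opt_time_le[OF m, of I "{}"] I m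
    by (simp add: uniform_instances_def zero_le_mult_iff)
  ultimately show ?case
    using T1_ge_1[OF m] by (simp add: load_def zero_le_mult_iff)
next
  case (place js \<sigma> D i j)
  let ?S' = "(\<sigma>(j := i), if upper_bound I j \<ge> T1 m then insert j D else D)"
  define L where "L = load I (set js) (\<sigma>, D) i"
  have j: "j \<notin> set js" "j < num_jobs I" and js: "set js \<subseteq> {..<num_jobs I}"
    using place.prems by auto
  have load: "load I (set js) (\<sigma>, D) k = (\<Sum>j\<in>{j \<in> set js. \<sigma> j = k}. sbs_time m I j)" for k
    using sbs_run_load[OF place.hyps(1)] by simp
  have load': "load I (set (js @ [j])) ?S' k =
      (\<Sum>x\<in>{x \<in> set (js @ [j]). (\<sigma>(j := i)) x = k}. sbs_time m I x)" for k
    using sbs_run_load[OF sbs_run.place[OF place.hyps]] by simp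
  show ?case
  proof (cases "k = i")
    case False
    then have "{x \<in> set (js @ [j]). (\<sigma>(j := i)) x = k} = {j \<in> set js. \<sigma> j = k}"
      using j(1) by auto
    then have "load I (set (js @ [j])) ?S' k = load I (set js) (\<sigma>, D) k"
      unfolding load' load by simp
    with place.IH place.prems show ?thesis by (simp add: sorted_wrt_append)
  next
    case True
    then have "{x \<in> set (js @ [j]). (\<sigma>(j := i)) x = k} = insert j {j \<in> set js. \<sigma> j = i}"
      using j(1) by auto
    then have "load I (set (js @ [j])) ?S' k = L + sbs_time m I j"
      unfolding load' L_def load using j(1) by simp
    also have "\<dots> \<le> T1 m * (3 / 2 - 1 / (2 * real m)) * OPT m I"
    proof (rule sbs_new_load_le[OF m I js j(2,1)])
      show "upper_bound I j \<le> upper_bound I k" if "k \<in> set js" for k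
        using that place.prems by (simp add: sorted_wrt_append)
      have \<sigma>: "\<sigma> ` set js \<subseteq> {..<m}" using sbs_run_schedule[OF place.hyps(1)] by auto
      \<comment> \<open>The least load is at most the average load.\<close>
      have "real m * L = (\<Sum>k<m. L)" by simp
      also have "\<dots> \<le> (\<Sum>k<m. load I (set js) (\<sigma>, D) k)"
        using place.hyps(3) unfolding L_def by (intro sum_mono) auto
      also have "\<dots> = sum (sbs_time m I) (set js)"
        unfolding load using \<sigma> by (intro sum.group) auto
      finally show "real m * L \<le> sum (sbs_time m I) (set js)" .
      show "L \<le> 0 \<or> m \<le> card (set js)"
      proof (rule disjCI)
        \<comment> \<open>Fewer than \<open>m\<close> placed jobs leave some machine empty, so the
          least load is at most 0.\<close>
        assume few: "\<not> m \<le> card (set js)"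
        have "card (\<sigma> ` set js) \<le> card (set js)" by (rule card_image_le) simp
        with few have "\<sigma> ` set js \<noteq> {..<m}" by auto
        then obtain k where k: "k < m" "k \<notin> \<sigma> ` set js" using \<sigma> by auto
        then have "{j \<in> set js. \<sigma> j = k} = {}" by auto
        then have "load I (set js) (\<sigma>, D) k = 0" unfolding load by (simp only: sum.empty)
        with place.hyps(3) k(1) show "L \<le> 0" unfolding L_def by force
      qed
    qed
    finally show ?thesis .
  qed
qed

theorem theorem4:
  fixes m :: nat
  assumes "m \<ge> 1"
  shows "competitive m uniform_instances (uniform_SBS m) (T1 m * (3 / 2 - 1 / (2 * real m)))"
  unfolding competitive_def
proof (intro ballI)
  fix I S assume I: "I \<in> uniform_instances" and "S \<in> uniform_SBS m I"
  then obtain js where js: "distinct js" "set js = {..<num_jobs I}"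
    "sorted_wrt (\<lambda>j k. upper_bound I j \<ge> upper_bound I k) js" "sbs_run m I js S"
    by (auto simp: uniform_SBS_def)
  have "{..<m} \<noteq> {}" using assms by (auto simp: lessThan_empty_iff)
  moreover have "load I {..<num_jobs I} S k \<le> T1 m * (3 / 2 - 1 / (2 * real m)) * OPT m I"
    if "k < m" for k
    using sbs_run_load_le[OF js(4) assms I js(1) _ js(3) that] js(2) by simp
  ultimately show "makespan m I S \<le> T1 m * (3 / 2 - 1 / (2 * real m)) * OPT m I"
    unfolding makespan_def by (intro Max.boundedI) auto
qed

end
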